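(* The equational theory of the class of algebras of binary relations of the signature $\{;,+,{}^*,0,1,\mathrm{D}\}$ is decidable: there is an algorithm that, given $\{;,+,{}^*,0,1,\mathrm{D}\}$-terms $s$ and $t$, decides whether $s=t$ holds in every such algebra under every assignment of its elements to the variables.
   Context: An algebra of binary relations of signature $\{;,+,{}^*,0,1,\mathrm{D}\}$ is a set of binary relations on a common base $X$ closed under composition $R;S=\{(x,y):\exists z\,(x,z)\in R,(z,y)\in S\}$, union $+$, reflexive transitive closure $R^*=\bigcup_{n\ge0}R^n$ ($R^0$ the identity), domain $\mathrm{D}(R)=\{(x,x):\exists y\,(x,y)\in R\}$, and containing $0=\emptyset$ and $1=$ the identity relation on $X$, with these operations. *)

theory Defs
  imports Main "HOL-Library.Nat_Bijection"
begin

datatype trm =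
    Var nat
  | Zero
  | One
  | Comp trm trm
  | Plus trm trm
  | Star trm
  | Dom trm

(* Powers are taken relative to the base X: the library's R ^^ 0 and rtrancl use the
   identity on the whole type, not the identity on X. *)
primrec rel_pow :: "'a set \<Rightarrow> ('a \<times> 'a) set \<Rightarrow> nat \<Rightarrow> ('a \<times> 'a) set" where
  "rel_pow X R 0 = Id_on X"
| "rel_pow X R (Suc n) = rel_pow X R n O R"

definition rel_star :: "'a set \<Rightarrow> ('a \<times> 'a) set \<Rightarrow> ('a \<times> 'a) set" where
  "rel_star X R = (\<Union>n. rel_pow X R n)"

definition rel_dom :: "('a \<times> 'a) set \<Rightarrow> ('a \<times> 'a) set" where
  "rel_dom R = {(x, x) | x. \<exists>y. (x, y) \<in> R}"

lemma rel_star_eq_rtrancl: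
  assumes "R \<subseteq> X \<times> X"
  shows "rel_star X R = R\<^sup>* \<inter> X \<times> X"
proof -
  have *: "rel_pow X R n = (R ^^ n) \<inter> X \<times> X" for n
    by (induction n) (use assms in \<open>auto simp: Id_on_def\<close>)
  show ?thesis
    unfolding rel_star_def * by (auto simp: rtrancl_power)
qed

definition rel_algebra :: "'a set \<Rightarrow> ('a \<times> 'a) set set \<Rightarrow> bool" where
  "rel_algebra X A \<longleftrightarrow>
     (\<forall>R\<in>A. R \<subseteq> X \<times> X) \<and>
     {} \<in> A \<and> Id_on X \<in> A \<and>
     (\<forall>R\<in>A. \<forall>S\<in>A. R O S \<in> A) \<and>
     (\<forall>R\<in>A. \<forall>S\<in>A. R \<union> S \<in> A) \<and>
     (\<forall>R\<in>A. rel_star X R \<in> A) \<and>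
     (\<forall>R\<in>A. rel_dom R \<in> A)"

primrec interp :: "'a set \<Rightarrow> (nat \<Rightarrow> ('a \<times> 'a) set) \<Rightarrow> trm \<Rightarrow> ('a \<times> 'a) set" where
  "interp X v (Var i) = v i"
| "interp X v Zero = {}"
| "interp X v One = Id_on X"
| "interp X v (Comp s t) = interp X v s O interp X v t"
| "interp X v (Plus s t) = interp X v s \<union> interp X v t"
| "interp X v (Star s) = rel_star X (interp X v s)"
| "interp X v (Dom s) = rel_dom (interp X v s)"

(* The equations valid in all algebras of relations whose base is a set of elements of 'a. *)
definition eq_theory :: "'a itself \<Rightarrow> (trm \<times> trm) set" where
  "eq_theory _ =
     {(s, t). \<forall>(X :: 'a set) A v.
        rel_algebra X A \<and> (\<forall>i. v i \<in> A) \<longrightarrow> interp X v s = interp X v t}"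

(* Total recursive functions of arity n, as functions on argument lists of length n; their
   values on lists of other lengths are irrelevant (rule cong). Minimisation is restricted to
   regular functions, which yields exactly the total computable functions. *)
inductive recursive :: "nat \<Rightarrow> (nat list \<Rightarrow> nat) \<Rightarrow> bool" where
  zero: "recursive n (\<lambda>xs. 0)"
| succ: "recursive 1 (\<lambda>xs. Suc (xs ! 0))"
| proj: "i < n \<Longrightarrow> recursive n (\<lambda>xs. xs ! i)"
| comp: "recursive (length fs) g \<Longrightarrow> \<forall>f\<in>set fs. recursive n f \<Longrightarrow>
    recursive n (\<lambda>xs. g (map (\<lambda>f. f xs) fs))"
| prim: "recursive n g \<Longrightarrow> recursive (Suc (Suc n)) h \<Longrightarrow>
    recursive (Suc n) (\<lambda>xs. rec_nat (g (tl xs)) (\<lambda>k r. h (k # r # tl xs)) (hd xs))"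
| mini: "recursive (Suc n) g \<Longrightarrow> \<forall>xs. length xs = n \<longrightarrow> (\<exists>k. g (k # xs) = 0) \<Longrightarrow>
    recursive n (\<lambda>xs. LEAST k. g (k # xs) = 0)"
| cong: "recursive n f \<Longrightarrow> \<forall>xs. length xs = n \<longrightarrow> g xs = f xs \<Longrightarrow> recursive n g"

primrec trm_code :: "trm \<Rightarrow> nat" where
  "trm_code (Var i) = prod_encode (0, i)"
| "trm_code Zero = prod_encode (1, 0)"
| "trm_code One = prod_encode (2, 0)"
| "trm_code (Comp s t) = prod_encode (3, prod_encode (trm_code s, trm_code t))"
| "trm_code (Plus s t) = prod_encode (4, prod_encode (trm_code s, trm_code t))"
| "trm_code (Star s) = prod_encode (5, trm_code s)"
| "trm_code (Dom s) = prod_encode (6, trm_code s)"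

lemma trm_code_inject: "trm_code s = trm_code t \<longleftrightarrow> s = t"
proof (induction s arbitrary: t)
  case (Var x) then show ?case by (cases t) auto
next
  case Zero then show ?case by (cases t) auto
next
  case One then show ?case by (cases t) auto
next
  case (Comp s1 s2) then show ?case by (cases t) auto
next
  case (Plus s1 s2) then show ?case by (cases t) auto
next
  case (Star s) then show ?case by (cases t) auto
next
  case (Dom s) then show ?case by (cases t) auto
qed

definition decidable_eqs :: "(trm \<times> trm) set \<Rightarrow> bool" where
  "decidable_eqs E \<longleftrightarrow>
     (\<exists>f. recursive 2 f \<and>
          (\<forall>s t. f [trm_code s, trm_code t] = (if (s, t) \<in> E then 1 else 0)))"

end

theory Submission
  imports Defs
begin

text \<open>If \<open>(x, y)\<close> lies in \<open>s\<close> but not in \<open>t\<close>, filtrate the base as for propositional dynamic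
  logic: identify points that belong to the same sets of the closure of \<open>\<langle>t\<rangle>{y}\<close>. The quotient
  map is a homomorphism, so it preserves membership in \<open>s\<close>, and the closure is large enough for
  the image of \<open>(x, y)\<close> to stay outside \<open>t\<close>. Hence an equation that fails has a countermodel of
  size exponential in its code. Such a model, together with the values of all subterms, is a finite
  set of numbers, and the search for it uses only bounded quantifiers; the star is expressed by
  quantifying over the subsets of the base closed under the relation.\<close>

section \<open>Small countermodels\<close>

lemma interp_subset:
  assumes "\<And>i. v i \<subseteq> X \<times> X"
  shows "interp X v r \<subseteq> X \<times> X"
proof (induction r)
  case (Star r)
  then show ?case by (simp add: rel_star_eq_rtrancl)
qed (use assms in \<open>auto simp: rel_dom_def\<close>)

lemma rel_algebra_Pow: "rel_algebra X (Pow (X \<times> X))"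
  unfolding rel_algebra_def by (auto simp: rel_star_eq_rtrancl rel_dom_def)

lemma eq_theory_iff:
  "(s, t) \<in> eq_theory TYPE('a) \<longleftrightarrow>
    (\<forall>(X :: 'a set) v. (\<forall>i. v i \<subseteq> X \<times> X) \<longrightarrow> interp X v s = interp X v t)"
proof
  assume st: "(s, t) \<in> eq_theory TYPE('a)"
  show "\<forall>(X :: 'a set) v. (\<forall>i. v i \<subseteq> X \<times> X) \<longrightarrow> interp X v s = interp X v t"
  proof (intro allI impI)
    fix X :: "'a set" and v :: "nat \<Rightarrow> ('a \<times> 'a) set"
    assume "\<forall>i. v i \<subseteq> X \<times> X"
    then have "rel_algebra X (Pow (X \<times> X)) \<and> (\<forall>i. v i \<in> Pow (X \<times> X))"
      by (simp add: rel_algebra_Pow)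
    then show "interp X v s = interp X v t"
      using st unfolding eq_theory_def by blast
  qed
next
  assume eq: "\<forall>(X :: 'a set) v. (\<forall>i. v i \<subseteq> X \<times> X) \<longrightarrow> interp X v s = interp X v t"
  have "interp X v s = interp X v t" if "rel_algebra X A" "\<forall>i. v i \<in> A" for X :: "'a set" and A v
  proof -
    have "\<forall>i. v i \<subseteq> X \<times> X" using that by (simp add: rel_algebra_def)
    then show ?thesis using eq by simp
  qed
  then show "(s, t) \<in> eq_theory TYPE('a)"
    unfolding eq_theory_def by (intro CollectI case_prodI allI impI) (elim conjE)
qed

lemma eq_theoryD:
  fixes X :: "'a set"
  assumes "(s, t) \<in> eq_theory TYPE('a)" "\<And>i. v i \<subseteq> X \<times> X"
  shows "interp X v s = interp X v t"
  using assms unfolding eq_theory_iff by simp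

text \<open>The semantic counterpart of the Fischer--Ladner closure of the modal formula
  \<open>\<langle>r\<rangle>K\<close>, where a subset \<open>K\<close> of the base plays the role of a formula.\<close>

primrec closure :: "'a set \<Rightarrow> (nat \<Rightarrow> ('a \<times> 'a) set) \<Rightarrow> trm \<Rightarrow> 'a set \<Rightarrow> 'a set set" where
  "closure X v (Var i) K = {K, (v i)\<inverse> `` K}"
| "closure X v Zero K = {K}"
| "closure X v One K = {K}"
| "closure X v (Comp a b) K = closure X v a ((interp X v b)\<inverse> `` K) \<union> closure X v b K"
| "closure X v (Plus a b) K = closure X v a K \<union> closure X v b K"
| "closure X v (Star a) K = insert K (closure X v a ((interp X v (Star a))\<inverse> `` K))"
| "closure X v (Dom a) K = insert K (closure X v a X)"

section \<open>Codes and the size of the closure\<close>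

lemma prod_encode_ge: "2 * m + n \<le> prod_encode (m, n)"
proof -
  have "k \<le> triangle k" for k by (induction k) auto
  from this[of "m + n"] show ?thesis by (simp add: prod_encode_def)
qed

lemma finite_closure: "finite (closure X v r K)"
  by (induction r arbitrary: K) auto

text \<open>Each operation adds at most one set to the closures of its arguments, and by
  \<open>prod_encode_ge\<close> its tag, counted twice, absorbs the extra constants. The summand 2
  is due to \<open>Var 0\<close>, whose code is 0 and whose closure may have two elements.\<close>

lemma card_closure: "card (closure X v r K) \<le> trm_code r + 2"
proof (induction r arbitrary: K)
  case (Var i)
  then show ?case by (simp add: card_insert_if)
next
  case (Comp a b)
  have "card (closure X v (Comp a b) K) \<le> (trm_code a + 2) + (trm_code b + 2)"
    using order_trans[OF card_Un_le add_mono[OF Comp.IH]] by simp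
  then show ?case
    using prod_encode_ge[of 3 "prod_encode (trm_code a, trm_code b)"]
      prod_encode_ge[of "trm_code a" "trm_code b"] by simp
next
  case (Plus a b)
  have "card (closure X v (Plus a b) K) \<le> (trm_code a + 2) + (trm_code b + 2)"
    using order_trans[OF card_Un_le add_mono[OF Plus.IH]] by simp
  then show ?case
    using prod_encode_ge[of 4 "prod_encode (trm_code a, trm_code b)"]
      prod_encode_ge[of "trm_code a" "trm_code b"] by simp
next
  case (Star a)
  have "card (closure X v (Star a) K) \<le> Suc (trm_code a + 2)"
    using Star[of "(interp X v (Star a))\<inverse> `` K"] by (simp add: card_insert_if finite_closure)
  then show ?case using prod_encode_ge[of 5 "trm_code a"] by simp
next
  case (Dom a)
  have "card (closure X v (Dom a) K) \<le> Suc (trm_code a + 2)"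
    using Dom[of X] by (simp add: card_insert_if finite_closure)
  then show ?case using prod_encode_ge[of 6 "trm_code a"] by simp
qed simp_all

section \<open>Filtration: the quotient map and its partial converse\<close>

lemma interp_image:
  assumes v: "\<And>i. v i \<subseteq> X \<times> X"
  assumes "(x, y) \<in> interp X v r"
  shows "(h x, h y) \<in> interp (h ` X) (\<lambda>i. map_prod h h ` v i) r"
  using assms(2)
proof (induction r arbitrary: x y)
  case (Star r)
  let ?R = "interp X v r" and ?S = "interp (h ` X) (\<lambda>i. map_prod h h ` v i) r"
  have S: "?S \<subseteq> h ` X \<times> h ` X"
    by (rule interp_subset) (use v in fastforce)
  have "(x, y) \<in> ?R\<^sup>*" "x \<in> X" "y \<in> X"
    using Star.prems rel_star_eq_rtrancl[OF interp_subset[OF v]] by auto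
  from this(1) have "(h x, h y) \<in> ?S\<^sup>*"
    by induction (auto intro: rtrancl_into_rtrancl Star.IH)
  then show ?case
    using \<open>x \<in> X\<close> \<open>y \<in> X\<close> by (simp add: rel_star_eq_rtrancl[OF S])
\<comment> \<open>The other operations are unions and existential conditions, so the image of a
  witness is again a witness.\<close>
qed (force simp: rel_dom_def)+

definition saturated :: "('a \<Rightarrow> 'b) \<Rightarrow> 'a set \<Rightarrow> 'a set \<Rightarrow> bool" where
  "saturated h X F \<longleftrightarrow> (\<forall>x\<in>X. \<forall>y\<in>X. h x = h y \<longrightarrow> x \<in> F \<longrightarrow> y \<in> F)"

lemma saturatedD: "saturated h X F \<Longrightarrow> x \<in> F \<Longrightarrow> x \<in> X \<Longrightarrow> y \<in> X \<Longrightarrow> h x = h y \<Longrightarrow> y \<in> F"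
  unfolding saturated_def by blast

text \<open>A step in the quotient joins only some representatives of two classes; saturation of the
  closure sets allows a change of representative at every step. The conclusion therefore speaks of
  reaching \<open>K\<close> rather than \<open>y\<close>; for \<open>K = {y}\<close> the two
  agree.\<close>

lemma interp_image_closure:
  assumes v: "\<And>i. v i \<subseteq> X \<times> X"
  assumes "\<And>F. F \<in> closure X v r K \<Longrightarrow> saturated h X F"
  assumes "(h x, h y) \<in> interp (h ` X) (\<lambda>i. map_prod h h ` v i) r" "x \<in> X" "y \<in> X" "y \<in> K"
  shows "x \<in> (interp X v r)\<inverse> `` K"
  using assms(2-)
proof (induction r arbitrary: K x y)
  case (Var i)
  from Var.prems(2) obtain x' y' where xy: "(x', y') \<in> v i" "h x = h x'" "h y = h y'"
    by auto
  with v have X: "x' \<in> X" "y' \<in> X" by blast+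
  \<comment> \<open>The edge joins \<open>x'\<close> to \<open>y'\<close>. Saturation of
    \<open>K\<close> leads from \<open>y\<close> to \<open>y'\<close>, and saturation of the
    preimage of \<open>K\<close> leads from \<open>x'\<close> back to \<open>x\<close>.\<close>
  have "y' \<in> K"
    by (rule saturatedD[OF Var.prems(1) Var.prems(5,4) X(2) xy(3)]) simp
  then have "x' \<in> (v i)\<inverse> `` K" using xy by blast
  then have "x \<in> (v i)\<inverse> `` K"
    by (rule saturatedD[OF Var.prems(1) _ X(1) Var.prems(3) xy(2)[symmetric], rotated]) simp
  then show ?case by simp
next
  case Zero
  then show ?case by simp
next
  case One
  have "h y = h x" using One.prems(2) by auto
  then have "x \<in> K" using saturatedD[OF One.prems(1), of K y x] One.prems(3-) by simp
  then show ?case using One.prems by auto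
next
  case (Comp a b)
  let ?v = "\<lambda>i. map_prod h h ` v i"
  have sub: "interp (h ` X) ?v b \<subseteq> h ` X \<times> h ` X"
    by (rule interp_subset) (use v in fastforce)
  obtain q where q: "(h x, q) \<in> interp (h ` X) ?v a" "(q, h y) \<in> interp (h ` X) ?v b"
    using Comp.prems(2) by auto
  with sub obtain z where z: "z \<in> X" "q = h z" by auto
  \<comment> \<open>The preimage of \<open>K\<close> under \<open>b\<close> then serves as the
    target set for \<open>a\<close>, as in the closure of \<open>Comp a b\<close>.\<close>
  have "z \<in> (interp X v b)\<inverse> `` K"
    by (rule Comp.IH(2)[where y = y]) (use Comp.prems q z in auto)
  then have "x \<in> (interp X v a)\<inverse> `` ((interp X v b)\<inverse> `` K)"
    by (intro Comp.IH(1)[where y = z]) (use Comp.prems q z in auto)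
  then show ?case by auto
next
  case (Plus a b)
  from Plus.prems(2) consider "(h x, h y) \<in> interp (h ` X) (\<lambda>i. map_prod h h ` v i) a"
    | "(h x, h y) \<in> interp (h ` X) (\<lambda>i. map_prod h h ` v i) b" by auto
  then show ?case
  proof cases
    case 1
    have "x \<in> (interp X v a)\<inverse> `` K"
      by (rule Plus.IH(1)[where y = y]) (use Plus.prems 1 in auto)
    then show ?thesis by auto
  next
    case 2
    have "x \<in> (interp X v b)\<inverse> `` K"
      by (rule Plus.IH(2)[where y = y]) (use Plus.prems 2 in auto)
    then show ?thesis by auto
  qed
next
  case (Star a)
  let ?S = "interp (h ` X) (\<lambda>i. map_prod h h ` v i) a"
  let ?L = "(interp X v (Star a))\<inverse> `` K"
  have S: "?S \<subseteq> h ` X \<times> h ` X"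
    by (rule interp_subset) (use v in fastforce)
  have R: "interp X v a \<subseteq> X \<times> X" by (rule interp_subset[OF v])
  note star = rel_star_eq_rtrancl[OF R]
  have "(h x, h y) \<in> ?S\<^sup>*"
    using Star.prems(2) by (simp add: rel_star_eq_rtrancl[OF S])
  \<comment> \<open>The induction runs backwards along the quotient path. Its points have no
    preferred representative, so the invariant puts all representatives into
    \<open>?L\<close>.\<close>
  then have "\<forall>x'\<in>X. h x = h x' \<longrightarrow> x' \<in> ?L"
  proof (induction rule: converse_rtrancl_induct)
    case base
    show ?case
    proof (intro ballI impI)
      fix u assume u: "u \<in> X" "h y = h u"
      then have "u \<in> K" using saturatedD[OF Star.prems(1), of K y u] Star.prems(3-) by simp
      then show "u \<in> ?L" using u by (auto simp: star)
    qed
  next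
    case (step p q)
    show ?case
    proof (intro ballI impI)
      fix u assume u: "u \<in> X" "p = h u"
      obtain z where z: "z \<in> X" "q = h z" using step.hyps(1) S by auto
      \<comment> \<open>\<open>?L\<close> is itself the target set used in the closure of
        \<open>Star a\<close>, so the hypothesis for \<open>a\<close> applies; a step by
        \<open>a\<close> into \<open>?L\<close> starts in \<open>?L\<close>.\<close>
      have "u \<in> (interp X v a)\<inverse> `` ?L"
        by (rule Star.IH[where y = z]) (use Star.prems step z u in auto)
      then show "u \<in> ?L"
        using u by (auto simp: star intro: converse_rtrancl_into_rtrancl)
    qed
  qed
  then show ?case using Star.prems by blast
next
  case (Dom a)
  let ?S = "interp (h ` X) (\<lambda>i. map_prod h h ` v i) a"
  have S: "?S \<subseteq> h ` X \<times> h ` X"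
    by (rule interp_subset) (use v in fastforce)
  obtain q where q: "(h x, q) \<in> ?S" "h y = h x"
    using Dom.prems(2) by (auto simp: rel_dom_def)
  with S obtain z where z: "z \<in> X" "q = h z" by auto
  \<comment> \<open>Lying in the domain of \<open>a\<close> means reaching the whole base, hence the
    target \<open>X\<close>.\<close>
  have "x \<in> (interp X v a)\<inverse> `` X"
    by (rule Dom.IH[where y = z]) (use Dom.prems q z in auto)
  moreover have "x \<in> K" using saturatedD[OF Dom.prems(1), of K y x] Dom.prems(3-) q by simp
  ultimately show ?case by (auto simp: rel_dom_def)
qed

section \<open>Countermodels of bounded size\<close>

lemma small_countermodel_le:
  assumes v: "\<And>i. v i \<subseteq> X \<times> X"
  assumes xy: "(x, y) \<in> interp X v s" "(x, y) \<notin> interp X v t"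
  obtains n :: nat and w where "n \<le> 2 ^ (trm_code t + 2)" "\<forall>i. w i \<subseteq> {..<n} \<times> {..<n}"
    "interp {..<n} w s \<noteq> interp {..<n} w t"
proof -
  let ?C = "closure X v t {y}"
  \<comment> \<open>\<open>k x\<close> is the type of \<open>x\<close>. Points of equal type are
    identified, so there are at most \<open>2 ^ card ?C\<close> classes.\<close>
  define k where "k x = {F \<in> ?C. x \<in> F}" for x
  have sub: "k ` X \<subseteq> Pow ?C" by (auto simp: k_def)
  have fin: "finite (k ` X)" by (rule finite_subset[OF sub]) (simp add: finite_closure)
  define n where "n = card (k ` X)"
  have "n \<le> card (Pow ?C)"
    unfolding n_def by (rule card_mono[OF _ sub]) (simp add: finite_closure)
  also have "\<dots> = 2 ^ card ?C" by (simp add: card_Pow finite_closure)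
  also have "\<dots> \<le> 2 ^ (trm_code t + 2)" by (intro power_increasing card_closure) simp
  finally have n: "n \<le> 2 ^ (trm_code t + 2)" .
  \<comment> \<open>Numbering the classes moves the quotient to an initial segment of the natural
    numbers.\<close>
  obtain g where g: "bij_betw g (k ` X) {..<n}"
    using ex_bij_betw_finite_nat[OF fin] by (auto simp: n_def atLeast0LessThan)
  define h where "h = g \<circ> k"
  define w where "w i = map_prod h h ` v i" for i
  have hX: "h ` X = {..<n}" 
    unfolding h_def image_comp[symmetric] by (rule bij_betw_imp_surj_on[OF g])
  have w: "w i \<subseteq> {..<n} \<times> {..<n}" for i
    unfolding w_def hX[symmetric] using v[of i] by fastforce
  have h_eq: "k a = k b" if "a \<in> X" "b \<in> X" "h a = h b" for a b
    using that g by (auto simp: h_def bij_betw_def inj_on_def)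
  have sat: "saturated h X F" if "F \<in> ?C" for F
  proof -
    have "a \<in> F \<longleftrightarrow> F \<in> k a" for a using that by (simp add: k_def)
    then show ?thesis using h_eq unfolding saturated_def by blast
  qed
  have X: "x \<in> X" "y \<in> X" using xy(1) interp_subset[of v X s, OF v] by auto
  have "(h x, h y) \<in> interp {..<n} w s"
    using interp_image[OF v xy(1), where h = h] by (simp add: hX w_def[abs_def])
  moreover have "(h x, h y) \<notin> interp {..<n} w t"
  proof
    assume "(h x, h y) \<in> interp {..<n} w t"
    then have "x \<in> (interp X v t)\<inverse> `` {y}"
      by (intro interp_image_closure[where h = h and y = y, OF v])
        (use X in \<open>auto simp: hX w_def[abs_def] sat\<close>)
    then show False using xy by auto
  qed
  ultimately show ?thesis using n w that by blast
qed

text \<open>Either inclusion may fail, and the closure is that of the term on the larger side of the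
  failing one; the sum of the codes covers both cases.\<close>

lemma small_countermodel:
  assumes "(s, t) \<notin> eq_theory TYPE('a)"
  obtains n :: nat and w where "n \<le> 2 ^ (trm_code s + trm_code t + 2)" "\<forall>i. w i \<subseteq> {..<n} \<times> {..<n}"
    "interp {..<n} w s \<noteq> interp {..<n} w t"
proof -
  obtain X :: "'a set" and v where v: "\<And>i. v i \<subseteq> X \<times> X" and ne: "interp X v s \<noteq> interp X v t"
    using assms unfolding eq_theory_iff by blast
  have le: "(2::nat) ^ (trm_code s + 2) \<le> 2 ^ (trm_code s + trm_code t + 2)"
    "(2::nat) ^ (trm_code t + 2) \<le> 2 ^ (trm_code s + trm_code t + 2)"
    by (intro power_increasing; simp)+
  from ne consider x y where "(x, y) \<in> interp X v s" "(x, y) \<notin> interp X v t"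
    | x y where "(x, y) \<in> interp X v t" "(x, y) \<notin> interp X v s" by auto
  then show ?thesis
  proof cases
    case 1
    from small_countermodel_le[OF v 1] show ?thesis using that le order_trans by metis
  next
    case 2
    from small_countermodel_le[OF v 2] show ?thesis using that le order_trans by metis
  qed
qed

text \<open>The filtrated countermodel has a base of numbers, whatever the type of the original
  base.\<close>

lemma eq_theory_nat_subset: "eq_theory TYPE(nat) \<subseteq> eq_theory TYPE('a)"
proof (rule subrelI, rule ccontr)
  fix s t assume st: "(s, t) \<in> eq_theory TYPE(nat)" and "(s, t) \<notin> eq_theory TYPE('a)"
  from small_countermodel[OF this(2)] obtain n :: nat and w where "n \<le> 2 ^ (trm_code s + trm_code t + 2)"
    "\<forall>i. w i \<subseteq> {..<n} \<times> {..<n}" "interp {..<n} w s \<noteq> interp {..<n} w t"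
    by blast
  with st show False unfolding eq_theory_iff by blast
qed

section \<open>Countermodels as numbers\<close>

abbreviation entry :: "nat \<Rightarrow> nat \<Rightarrow> nat \<Rightarrow> nat \<Rightarrow> bool" where
  "entry T c x y \<equiv> prod_encode (c, prod_encode (x, y)) \<in> set_decode T"

text \<open>Row \<open>c\<close> of \<open>T\<close> is meant to be the value of the term with code
  \<open>c\<close>. Rows with tag 0 are left free: they are the assignment. \<open>M\<close> bounds
  the codes of arguments.\<close>

definition table :: "nat \<Rightarrow> nat \<Rightarrow> nat \<Rightarrow> bool" where
  "table M n T \<longleftrightarrow> (\<forall>x<n. \<forall>y<n.
     \<not> entry T (prod_encode (1, 0)) x y \<and>
     (entry T (prod_encode (2, 0)) x y \<longleftrightarrow> x = y) \<and>
     (\<forall>a<M.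
       (entry T (prod_encode (5, a)) x y \<longleftrightarrow>
         (\<forall>S<2 ^ n. x \<in> set_decode S \<and>
           (\<forall>u<n. \<forall>w<n. u \<in> set_decode S \<and> entry T a u w \<longrightarrow> w \<in> set_decode S) \<longrightarrow>
           y \<in> set_decode S)) \<and>
       (entry T (prod_encode (6, a)) x y \<longleftrightarrow> x = y \<and> (\<exists>z<n. entry T a x z)) \<and>
       (\<forall>b<M.
         (entry T (prod_encode (3, prod_encode (a, b))) x y \<longleftrightarrow>
           (\<exists>z<n. entry T a x z \<and> entry T b z y)) \<and>
         (entry T (prod_encode (4, prod_encode (a, b))) x y \<longleftrightarrow>
           entry T a x y \<or> entry T b x y))))"

text \<open>Turns quantifiers over subsets of an initial segment into bounded quantifiers over
  numbers.\<close>

lemma set_decode_subset_lessThan: "T < 2 ^ m \<longleftrightarrow> set_decode T \<subseteq> {..<m}"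
proof
  assume T: "T < 2 ^ m"
  show "set_decode T \<subseteq> {..<m}"
  proof
    fix k assume "k \<in> set_decode T"
    then have "T div 2 ^ k \<noteq> 0" by (metis set_decode_def mem_Collect_eq even_zero)
    then have "2 ^ k \<le> T" by (metis div_less not_le)
    from this T have "(2::nat) ^ k < 2 ^ m" by (rule le_less_trans)
    then show "k \<in> {..<m}" by simp
  qed
next
  assume "set_decode T \<subseteq> {..<m}"
  then have "set_encode (set_decode T) \<le> set_encode {..<m}"
    unfolding set_encode_def by (intro sum_mono2) auto
  also have "set_encode {..<m} < 2 ^ m"
    unfolding set_encode_def by (induction m) (auto simp: lessThan_Suc)
  finally show "T < 2 ^ m" by simp
qed

text \<open>The points reachable from \<open>x\<close> form the least closed set containing
  \<open>x\<close>; this set is the instance used for the converse.\<close>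

lemma rtrancl_iff_all_closed:
  assumes "x < n" "y < n"
  shows "(x, y) \<in> ({(u, w). u < n \<and> w < n \<and> Q u w})\<^sup>* \<longleftrightarrow>
    (\<forall>S<2 ^ n. x \<in> set_decode S \<and>
      (\<forall>u<n. \<forall>w<n. u \<in> set_decode S \<and> Q u w \<longrightarrow> w \<in> set_decode S) \<longrightarrow>
      y \<in> set_decode S)" (is "_ \<in> ?R\<^sup>* \<longleftrightarrow> ?rhs")
proof
  assume xy: "(x, y) \<in> ?R\<^sup>*"
  show ?rhs
  proof (intro allI impI, elim conjE)
    fix S :: nat
    assume "x \<in> set_decode S"
      and cl: "\<forall>u<n. \<forall>w<n. u \<in> set_decode S \<and> Q u w \<longrightarrow> w \<in> set_decode S"
    from xy this(1) show "y \<in> set_decode S"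
      by induction (use cl in auto)
  qed
next
  assume rhs: ?rhs
  let ?S = "{w. w < n \<and> (x, w) \<in> ?R\<^sup>*}"
  have dec: "set_decode (set_encode ?S) = ?S" by (rule set_encode_inverse) simp
  have "set_encode ?S < 2 ^ n" unfolding set_decode_subset_lessThan dec by auto
  moreover have "x \<in> ?S" using assms by simp
  moreover have "\<forall>u<n. \<forall>w<n. u \<in> ?S \<and> Q u w \<longrightarrow> w \<in> ?S"
    by (auto intro: rtrancl_into_rtrancl)
  ultimately have "y \<in> ?S"
    using rhs[rule_format, of "set_encode ?S"] unfolding dec by blast
  then show "(x, y) \<in> ?R\<^sup>*" by simp
qed

lemma trm_code_less:
  "trm_code a < trm_code (Comp a b)" "trm_code b < trm_code (Comp a b)"
  "trm_code a < trm_code (Plus a b)" "trm_code b < trm_code (Plus a b)"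
  "trm_code a < trm_code (Star a)" "trm_code a < trm_code (Dom a)"
  using prod_encode_ge[of "trm_code a" "trm_code b"]
    prod_encode_ge[of 3 "prod_encode (trm_code a, trm_code b)"]
    prod_encode_ge[of 4 "prod_encode (trm_code a, trm_code b)"]
    prod_encode_ge[of 5 "trm_code a"] prod_encode_ge[of 6 "trm_code a"]
  by simp_all

lemma tableD:
  assumes "table M n T" "x < n" "y < n"
  shows "\<not> entry T (prod_encode (1, 0)) x y"
    "entry T (prod_encode (2, 0)) x y \<longleftrightarrow> x = y"
    "a < M \<Longrightarrow> b < M \<Longrightarrow> entry T (prod_encode (3, prod_encode (a, b))) x y \<longleftrightarrow>
      (\<exists>z<n. entry T a x z \<and> entry T b z y)"
    "a < M \<Longrightarrow> b < M \<Longrightarrow> entry T (prod_encode (4, prod_encode (a, b))) x y \<longleftrightarrow>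
      entry T a x y \<or> entry T b x y"
    "a < M \<Longrightarrow> entry T (prod_encode (5, a)) x y \<longleftrightarrow>
      (\<forall>S<2 ^ n. x \<in> set_decode S \<and>
        (\<forall>u<n. \<forall>w<n. u \<in> set_decode S \<and> entry T a u w \<longrightarrow> w \<in> set_decode S) \<longrightarrow>
        y \<in> set_decode S)"
    "a < M \<Longrightarrow> entry T (prod_encode (6, a)) x y \<longleftrightarrow> x = y \<and> (\<exists>z<n. entry T a x z)"
proof -
  note 1 = assms(1)[unfolded table_def, THEN spec, THEN mp, OF assms(2), THEN spec, THEN mp, OF assms(3)]
  note 2 = 1[THEN conjunct2]
  note 3 = 2[THEN conjunct2, THEN spec, THEN mp]
  note 4 = 3[THEN conjunct2]
  note 5 = 4[THEN conjunct2, THEN spec, THEN mp]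
  show "\<not> entry T (prod_encode (1, 0)) x y" by (rule 1[THEN conjunct1])
  show "entry T (prod_encode (2, 0)) x y \<longleftrightarrow> x = y" by (rule 2[THEN conjunct1])
  show "entry T (prod_encode (3, prod_encode (a, b))) x y \<longleftrightarrow>
      (\<exists>z<n. entry T a x z \<and> entry T b z y)" if "a < M" "b < M"
    by (rule 5[THEN conjunct1, OF that])
  show "entry T (prod_encode (4, prod_encode (a, b))) x y \<longleftrightarrow>
      entry T a x y \<or> entry T b x y" if "a < M" "b < M"
    by (rule 5[THEN conjunct2, OF that])
  show "entry T (prod_encode (5, a)) x y \<longleftrightarrow>
      (\<forall>S<2 ^ n. x \<in> set_decode S \<and>
        (\<forall>u<n. \<forall>w<n. u \<in> set_decode S \<and> entry T a u w \<longrightarrow> w \<in> set_decode S) \<longrightarrow>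
        y \<in> set_decode S)" if "a < M"
    by (rule 3[THEN conjunct1, OF that])
  show "entry T (prod_encode (6, a)) x y \<longleftrightarrow> x = y \<and> (\<exists>z<n. entry T a x z)" if "a < M"
    by (rule 4[THEN conjunct1, OF that])
qed

text \<open>Any table, wherever it comes from, describes a model: its variable rows give
  \<open>v\<close>, and the clauses force the other rows by induction. Codes of proper subterms are
  strictly smaller, so \<open>trm_code r \<le> M\<close> puts the arguments below
  \<open>M\<close>.\<close>

lemma table_interp:
  assumes T: "table M n T"
  defines "v \<equiv> \<lambda>i. {(x, y). x < n \<and> y < n \<and> entry T (prod_encode (0, i)) x y}"
  assumes "trm_code r \<le> M" "x < n" "y < n"
  shows "entry T (trm_code r) x y \<longleftrightarrow> (x, y) \<in> interp {..<n} v r"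
  using assms(3-)
proof (induction r arbitrary: x y)
  case (Var i)
  then show ?case by (simp add: v_def)
next
  case Zero
  then show ?case using tableD(1)[OF T Zero(2,3)] by simp
next
  case One
  then show ?case using tableD(2)[OF T One(2,3)] by auto
next
  case (Comp a b)
  have less: "trm_code a < M" "trm_code b < M"
    using trm_code_less(1,2)[of a b] trm_code_less(2)[of b a] Comp.prems(1) by linarith+
  have "entry T (trm_code (Comp a b)) x y \<longleftrightarrow>
      (\<exists>z<n. entry T (trm_code a) x z \<and> entry T (trm_code b) z y)"
    unfolding trm_code.simps by (rule tableD(3)[OF T Comp.prems(2,3) less])
  also have "\<dots> \<longleftrightarrow> (\<exists>z<n. (x, z) \<in> interp {..<n} v a \<and> (z, y) \<in> interp {..<n} v b)"
    using Comp less by auto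
  also have "\<dots> \<longleftrightarrow> (x, y) \<in> interp {..<n} v (Comp a b)"
    using interp_subset[of v "{..<n}" a] by (auto simp: v_def)
  finally show ?case .
next
  case (Plus a b)
  have less: "trm_code a < M" "trm_code b < M"
    using trm_code_less(3,4)[of a b] trm_code_less(4)[of b a] Plus.prems(1) by linarith+
  have "entry T (trm_code (Plus a b)) x y \<longleftrightarrow>
      entry T (trm_code a) x y \<or> entry T (trm_code b) x y"
    unfolding trm_code.simps by (rule tableD(4)[OF T Plus.prems(2,3) less])
  then show ?case using Plus less by auto
next
  case (Star a)
  have less: "trm_code a < M"
    using trm_code_less(5)[of a] Star.prems(1) by linarith
  have sub: "interp {..<n} v a \<subseteq> {..<n} \<times> {..<n}"
    by (rule interp_subset) (auto simp: v_def)
  have eq: "{(u, w). u < n \<and> w < n \<and> entry T (trm_code a) u w} = interp {..<n} v a"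
    using Star.IH less sub by auto
  have "entry T (trm_code (Star a)) x y \<longleftrightarrow>
     (\<forall>S<2 ^ n. x \<in> set_decode S \<and>
           (\<forall>u<n. \<forall>w<n. u \<in> set_decode S \<and> entry T (trm_code a) u w \<longrightarrow> w \<in> set_decode S) \<longrightarrow>
           y \<in> set_decode S)"
    unfolding trm_code.simps by (rule tableD(5)[OF T Star.prems(2,3) less])
  then show ?case
    unfolding rtrancl_iff_all_closed[OF Star.prems(2,3), symmetric] eq
    using Star.prems by (simp add: rel_star_eq_rtrancl[OF sub])
next
  case (Dom a)
  have less: "trm_code a < M"
    using trm_code_less(6)[of a] Dom.prems(1) by linarith
  have sub: "interp {..<n} v a \<subseteq> {..<n} \<times> {..<n}"
    by (rule interp_subset) (auto simp: v_def)
  have "entry T (trm_code (Dom a)) x y \<longleftrightarrow> x = y \<and> (\<exists>z<n. entry T (trm_code a) x z)"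
    unfolding trm_code.simps by (rule tableD(6)[OF T Dom.prems(2,3) less])
  also have "\<dots> \<longleftrightarrow> x = y \<and> (\<exists>z<n. (x, z) \<in> interp {..<n} v a)"
    using Dom less by auto
  also have "\<dots> \<longleftrightarrow> (x, y) \<in> interp {..<n} v (Dom a)"
    using sub by (auto simp: rel_dom_def)
  finally show ?case .
qed

section \<open>Building a table from a model\<close>

lemma prod_decode_less:
  assumes "(k, d) = prod_decode c" "k \<noteq> 0"
  shows "fst (prod_decode d) < c \<and> snd (prod_decode d) < c \<and> d < c"
proof -
  have "prod_encode (k, d) = c" using assms(1) by simp
  then have "d < c" using prod_encode_ge[of k d] assms(2) by linarith
  moreover have "fst (prod_decode d) \<le> d" "snd (prod_decode d) \<le> d"
    using prod_encode_ge[of "fst (prod_decode d)" "snd (prod_decode d)"] by simp_all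
  ultimately show ?thesis by linarith
qed

text \<open>A total left inverse of \<open>trm_code\<close>: it lets a table contain an entry for every number,
  so that \<open>table\<close> need not single out the codes of terms.\<close>

function trm_decode :: "nat \<Rightarrow> trm" where
  "trm_decode c = (case prod_decode c of (k, d) \<Rightarrow>
     if k = 0 then Var d else if k = 1 then Zero else if k = 2 then One
     else if k = 3 then Comp (trm_decode (fst (prod_decode d))) (trm_decode (snd (prod_decode d)))
     else if k = 4 then Plus (trm_decode (fst (prod_decode d))) (trm_decode (snd (prod_decode d)))
     else if k = 5 then Star (trm_decode d)
     else Dom (trm_decode d))"
  by pat_completeness auto
termination
  by (relation "measure id") (auto dest: prod_decode_less)

declare trm_decode.simps [simp del]

text \<open>The defining equation of \<open>trm_decode\<close> matches its own recursive calls, so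
  the simplifier gets these instances at encoded arguments instead.\<close>

lemma trm_decode_simps [simp]:
  "trm_decode (prod_encode (0, i)) = Var i"
  "trm_decode (prod_encode (Suc 0, i)) = Zero"
  "trm_decode (prod_encode (2, i)) = One"
  "trm_decode (prod_encode (3, prod_encode (a, b))) = Comp (trm_decode a) (trm_decode b)"
  "trm_decode (prod_encode (4, prod_encode (a, b))) = Plus (trm_decode a) (trm_decode b)"
  "trm_decode (prod_encode (5, a)) = Star (trm_decode a)"
  "trm_decode (prod_encode (6, a)) = Dom (trm_decode a)"
  by (simp_all add: trm_decode.simps[of "prod_encode p" for p])

lemma trm_decode_code [simp]: "trm_decode (trm_code r) = r"
  by (induction r) simp_all

lemma prod_encode_mono: "a \<le> a' \<Longrightarrow> b \<le> b' \<Longrightarrow> prod_encode (a, b) \<le> prod_encode (a', b')"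
proof -
  have "mono triangle" by (rule mono_iff_le_Suc[THEN iffD2]) simp
  then show "prod_encode (a, b) \<le> prod_encode (a', b')" if "a \<le> a'" "b \<le> b'"
    unfolding prod_encode_def using that by (auto intro!: add_mono dest: monoD)
qed

text \<open>With 6 as the largest tag, arguments at most \<open>M\<close> and points below
  \<open>n\<close>, every position that \<open>table\<close> inspects lies below this
  number.\<close>

definition table_bound :: "nat \<Rightarrow> nat \<Rightarrow> nat" where
  "table_bound M n = Suc (prod_encode (prod_encode (6, prod_encode (M, M)), prod_encode (n, n)))"

lemma table_exists:
  assumes w: "\<forall>i. w i \<subseteq> {..<n} \<times> {..<n}"
  obtains T where "T < 2 ^ table_bound M n" "table M n T"
    "\<forall>c\<le>M. \<forall>x y. entry T c x y \<longleftrightarrow> (x, y) \<in> interp {..<n} w (trm_decode c)"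
proof -
  define D where "D = prod_encode (6, prod_encode (M, M))"
  let ?I = "\<lambda>c. interp {..<n} w (trm_decode c)"
  \<comment> \<open>Row \<open>c\<close> is filled even when \<open>c\<close> is not the code of a
    term. The cut-off \<open>D\<close> keeps the set finite and still covers the arguments and
    results of all clauses.\<close>
  let ?A = "{prod_encode (c, prod_encode (x, y)) | c x y. c \<le> D \<and> (x, y) \<in> ?I c}"
  define T where "T = set_encode ?A"
  have sub: "interp {..<n} w r \<subseteq> {..<n} \<times> {..<n}" for r
    by (rule interp_subset) (use w in blast)
  have A: "?A \<subseteq> {..<table_bound M n}"
  proof safe
    fix c x y assume "c \<le> D" "(x, y) \<in> ?I c"
    then have "prod_encode (c, prod_encode (x, y)) \<le> prod_encode (D, prod_encode (n, n))"
      using sub[of "trm_decode c"] by (intro prod_encode_mono) auto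
    then show "prod_encode (c, prod_encode (x, y)) < table_bound M n"
      by (simp add: table_bound_def D_def)
  qed
  then have "finite ?A" by (rule finite_subset) simp
  then have dec: "set_decode T = ?A" unfolding T_def by (rule set_encode_inverse)
  have T: "T < 2 ^ table_bound M n" unfolding set_decode_subset_lessThan dec by (rule A)
  have entry: "entry T c x y \<longleftrightarrow> (x, y) \<in> ?I c" if "c \<le> D" for c x y
    unfolding dec using that by auto
  have MD: "M \<le> D"
    using prod_encode_ge[of 6 "prod_encode (M, M)"] prod_encode_ge[of M M] by (simp add: D_def)
  have le: "prod_encode (k, prod_encode (a, b)) \<le> D" if "k \<le> 6" "a \<le> M" "b \<le> M" for k a b
    unfolding D_def using that by (intro prod_encode_mono)
  have le1: "prod_encode (k, a) \<le> D" if "k \<le> 6" "a \<le> M" for k a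
    unfolding D_def using that prod_encode_ge[of M M] by (intro prod_encode_mono) auto
  have star: "(x, y) \<in> interp {..<n} w (Star r) \<longleftrightarrow>
    (\<forall>S<2 ^ n. x \<in> set_decode S \<and>
      (\<forall>u<n. \<forall>v<n. u \<in> set_decode S \<and> (u, v) \<in> interp {..<n} w r \<longrightarrow> v \<in> set_decode S) \<longrightarrow>
      y \<in> set_decode S)" if "x < n" "y < n" for x y r
  proof -
    have "{(u, v). u < n \<and> v < n \<and> (u, v) \<in> interp {..<n} w r} = interp {..<n} w r"
      using sub by auto
    then show ?thesis
      unfolding rtrancl_iff_all_closed[OF that, symmetric]
      using that by (simp add: rel_star_eq_rtrancl[OF sub])
  qed
  have "table M n T"
    unfolding table_def
  proof (intro allI impI conjI)
    fix x y a b assume "x < n" "y < n" "a < M" "b < M"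
    then show "entry T (prod_encode (3, prod_encode (a, b))) x y \<longleftrightarrow>
        (\<exists>z<n. entry T a x z \<and> entry T b z y)"
      and "entry T (prod_encode (4, prod_encode (a, b))) x y \<longleftrightarrow> entry T a x y \<or> entry T b x y"
      using sub[of "trm_decode a"] MD by (auto simp: entry le)
  next
    fix x y a assume "x < n" "y < n" "a < M"
    then show "entry T (prod_encode (6, a)) x y \<longleftrightarrow> x = y \<and> (\<exists>z<n. entry T a x z)"
      using sub[of "trm_decode a"] MD by (auto simp: entry le1 rel_dom_def)
    show "entry T (prod_encode (5, a)) x y \<longleftrightarrow>
       (\<forall>S<2 ^ n. x \<in> set_decode S \<and>
         (\<forall>u<n. \<forall>w<n. u \<in> set_decode S \<and> entry T a u w \<longrightarrow> w \<in> set_decode S) \<longrightarrow>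
         y \<in> set_decode S)"
      using star[OF \<open>x < n\<close> \<open>y < n\<close>, of "trm_decode a"] MD \<open>a < M\<close>
      by (simp add: entry le1 del: interp.simps)
  next
    fix x y assume "x < n" "y < n"
    then show "\<not> entry T (prod_encode (1, 0)) x y" "entry T (prod_encode (2, 0)) x y \<longleftrightarrow> x = y"
      by (auto simp: entry le1)
  qed
  moreover have "\<forall>c\<le>M. \<forall>x y. entry T c x y \<longleftrightarrow> (x, y) \<in> ?I c"
    using MD by (simp add: entry)
  ultimately show ?thesis using T that by blast
qed

text \<open>\<open>Suc\<close> makes the bound of \<open>small_countermodel\<close> strict, and
  \<open>s + t\<close> is at least each of the two codes, as \<open>table_interp\<close>
  requires.\<close>

definition refutable :: "nat \<Rightarrow> nat \<Rightarrow> bool" where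
  "refutable s t \<longleftrightarrow> (\<exists>n<Suc (2 ^ (s + t + 2)). \<exists>T<2 ^ table_bound (s + t) n.
     table (s + t) n T \<and> (\<exists>x<n. \<exists>y<n. \<not> (entry T s x y \<longleftrightarrow> entry T t x y)))"

text \<open>A table directly yields a model on \<open>{..<n}\<close>; conversely, a failing equation
  has a small countermodel, whose table obeys the bounds.\<close>

lemma refutable_iff:
  "refutable (trm_code s) (trm_code t) \<longleftrightarrow> (s, t) \<notin> eq_theory TYPE(nat)"
proof
  assume "refutable (trm_code s) (trm_code t)"
  then obtain n T x y where T: "table (trm_code s + trm_code t) n T" and xy: "x < n" "y < n"
    and ne: "\<not> (entry T (trm_code s) x y \<longleftrightarrow> entry T (trm_code t) x y)"
    unfolding refutable_def by blast
  let ?v = "\<lambda>i. {(x, y). x < n \<and> y < n \<and> entry T (prod_encode (0, i)) x y}"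
  have "interp {..<n} ?v s \<noteq> interp {..<n} ?v t"
    using ne table_interp[OF T _ xy, of s] table_interp[OF T _ xy, of t] by auto
  moreover have "?v i \<subseteq> {..<n} \<times> {..<n}" for i by auto
  ultimately show "(s, t) \<notin> eq_theory TYPE(nat)"
    using eq_theoryD[of s t ?v "{..<n}"] by (metis (lifting))
next
  assume "(s, t) \<notin> eq_theory TYPE(nat)"
  from small_countermodel[OF this] obtain n :: nat and w where n: "n \<le> 2 ^ (trm_code s + trm_code t + 2)"
    and w: "\<forall>i. w i \<subseteq> {..<n} \<times> {..<n}" and ne: "interp {..<n} w s \<noteq> interp {..<n} w t"
    by blast
  obtain T where T: "T < 2 ^ table_bound (trm_code s + trm_code t) n"
    "table (trm_code s + trm_code t) n T"
    and entry: "\<forall>c\<le>trm_code s + trm_code t. \<forall>x y.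
      entry T c x y \<longleftrightarrow> (x, y) \<in> interp {..<n} w (trm_decode c)"
    using table_exists[OF w, of "trm_code s + trm_code t"] by blast
  obtain x y where xy: "((x, y) \<in> interp {..<n} w s) \<noteq> ((x, y) \<in> interp {..<n} w t)"
    using ne by auto
  then have "x < n" "y < n"
    using interp_subset[of w "{..<n}" s] interp_subset[of w "{..<n}" t] w by auto
  moreover have "\<not> (entry T (trm_code s) x y \<longleftrightarrow> entry T (trm_code t) x y)"
    using xy by (simp add: entry)
  ultimately show "refutable (trm_code s) (trm_code t)"
    unfolding refutable_def using le_imp_less_Suc[OF n] T by blast
qed

section \<open>Recursiveness\<close>

text \<open>Arguments are given by an environment \<open>e\<close>, so that binding a variable shifts the others
  by \<open>\<lambda>i. e (Suc i)\<close> and the closure rules below apply by plain unification.\<close>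

definition rec_fun :: "nat \<Rightarrow> ((nat \<Rightarrow> nat) \<Rightarrow> nat) \<Rightarrow> bool" where
  "rec_fun n F \<longleftrightarrow> recursive n (\<lambda>xs. F (\<lambda>i. xs ! i))"

definition rec_pred :: "nat \<Rightarrow> ((nat \<Rightarrow> nat) \<Rightarrow> bool) \<Rightarrow> bool" where
  "rec_pred n P \<longleftrightarrow> rec_fun n (\<lambda>e. of_bool (P e))"

section \<open>Recursion and change of environment\<close>

lemma rec_fun_cong: "rec_fun n F \<Longrightarrow> (\<And>e. G e = F e) \<Longrightarrow> rec_fun n G"
  by presburger

lemma rec_pred_cong: "rec_pred n P \<Longrightarrow> (\<And>e. Q e \<longleftrightarrow> P e) \<Longrightarrow> rec_pred n Q"
  by presburger

lemma rec_fun_proj: "i < n \<Longrightarrow> rec_fun n (\<lambda>e. e i)"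
  unfolding rec_fun_def by (rule recursive.proj)

lemma rec_fun_Suc:
  assumes "rec_fun n f"
  shows "rec_fun n (\<lambda>e. Suc (f e))"
  using recursive.comp[of "[\<lambda>xs. f (\<lambda>i. xs ! i)]" "\<lambda>xs. Suc (xs ! 0)" n] recursive.succ assms
  by (simp add: rec_fun_def)

lemma rec_fun_const: "rec_fun n (\<lambda>e. c)"
proof (induction c)
  case 0
  show ?case unfolding rec_fun_def by (rule recursive.zero)
next
  case (Suc c)
  then show ?case by (rule rec_fun_Suc)
qed

text \<open>\<open>recursive.prim\<close> recurses on the first argument, so the value of
  \<open>b\<close> is placed in front of the environment. The step sees the counter, the accumulator
  and then the outer variables.\<close>

lemma rec_fun_rec_nat:
  assumes g: "rec_fun n g" and h: "rec_fun (Suc (Suc n)) (\<lambda>e. h (e 0) (e (Suc 0)) (\<lambda>i. e (Suc (Suc i))))"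
    and b: "rec_fun n b"
  shows "rec_fun n (\<lambda>e. rec_nat (g e) (\<lambda>k r. h k r e) (b e))"
proof -
  let ?P = "\<lambda>xs. rec_nat (g (\<lambda>i. tl xs ! i)) (\<lambda>k r. h k r (\<lambda>i. tl xs ! i)) (hd xs)"
  let ?fs = "(\<lambda>xs. b (\<lambda>i. xs ! i)) # map (\<lambda>i xs. xs ! i) [0..<n]"
  have "recursive (Suc n) ?P"
    using recursive.prim[OF g[unfolded rec_fun_def] h[unfolded rec_fun_def]] by simp
  then have "recursive n (\<lambda>xs. ?P (map (\<lambda>f. f xs) ?fs))"
    using b by (intro recursive.comp) (auto simp: rec_fun_def intro: recursive.proj)
  moreover have "map (\<lambda>f. f xs) ?fs = b (\<lambda>i. xs ! i) # xs" if "length xs = n" for xs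
    using that by (auto simp: comp_def map_nth)
  ultimately show ?thesis
    unfolding rec_fun_def by (elim recursive.cong) simp
qed

text \<open>Weakening, used to carry a function under a binder.\<close>

lemma rec_fun_shift:
  assumes "rec_fun n f"
  shows "rec_fun (Suc n) (\<lambda>e. f (\<lambda>i. e (Suc i)))"
proof -
  let ?fs = "map (\<lambda>i xs. xs ! Suc i) [0..<n] :: (nat list \<Rightarrow> nat) list"
  have "recursive (Suc n) (\<lambda>xs. f (\<lambda>i. map (\<lambda>f. f xs) ?fs ! i))"
    using assms unfolding rec_fun_def
    by (intro recursive.comp[where g = "\<lambda>xs. f (\<lambda>i. xs ! i)"]) (auto intro: recursive.proj)
  moreover have "map (\<lambda>f. f (x # xs)) ?fs = xs" if "length xs = n" for x xs
    using that by (auto simp: comp_def map_nth)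
  ultimately show ?thesis
    unfolding rec_fun_def by (elim recursive.cong) (auto simp: length_Suc_conv)
qed

text \<open>Weakening at position 1: in the search of \<open>rec_pred_ex\<close> this is the
  accumulator, which the body must not see.\<close>

lemma rec_fun_skip:
  assumes "rec_fun (Suc n) (\<lambda>e. f (e 0) (\<lambda>i. e (Suc i)))"
  shows "rec_fun (Suc (Suc n)) (\<lambda>e. f (e 0) (\<lambda>i. e (Suc (Suc i))))"
proof -
  let ?fs = "(\<lambda>xs. xs ! 0) # map (\<lambda>i xs. xs ! Suc (Suc i)) [0..<n] :: (nat list \<Rightarrow> nat) list"
  let ?g = "\<lambda>xs. f (xs ! 0) (\<lambda>i. xs ! Suc i)"
  have "recursive (Suc (Suc n)) (\<lambda>xs. ?g (map (\<lambda>f. f xs) ?fs))"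
    using assms unfolding rec_fun_def
    by (intro recursive.comp[where g = ?g]) (auto intro: recursive.proj)
  moreover have "map (\<lambda>f. f (x # y # xs)) ?fs = x # xs" if "length xs = n" for x y xs
    using that by (auto simp: comp_def map_nth)
  ultimately show ?thesis
    unfolding rec_fun_def by (elim recursive.cong) (auto simp: length_Suc_conv)
qed

section \<open>Arithmetic\<close>

lemma rec_fun_add:
  assumes "rec_fun n f" "rec_fun n g"
  shows "rec_fun n (\<lambda>e. f e + g e)"
proof (rule rec_fun_cong)
  show "rec_fun n (\<lambda>e. rec_nat (f e) (\<lambda>k r. Suc r) (g e))"
    by (intro rec_fun_rec_nat rec_fun_Suc rec_fun_proj assms) simp
  have "rec_nat a (\<lambda>k r. Suc r) b = a + b" for a b :: nat
    by (induction b) auto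
  then show "f e + g e = rec_nat (f e) (\<lambda>k r. Suc r) (g e)" for e by simp
qed

lemma rec_fun_mult:
  assumes "rec_fun n f" "rec_fun n g"
  shows "rec_fun n (\<lambda>e. f e * g e)"
proof (rule rec_fun_cong)
  have f: "rec_fun (Suc (Suc n)) (\<lambda>e. f (\<lambda>i. e (Suc (Suc i))))"
    using assms(1) by (intro rec_fun_shift)
  show "rec_fun n (\<lambda>e. rec_nat 0 (\<lambda>k r. r + f e) (g e))"
    by (intro rec_fun_rec_nat rec_fun_add rec_fun_const rec_fun_proj f assms) simp
  have "rec_nat 0 (\<lambda>k r. r + a) b = a * b" for a b :: nat
    by (induction b) auto
  then show "f e * g e = rec_nat 0 (\<lambda>k r. r + f e) (g e)" for e by simp
qed

lemma rec_fun_power: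
  assumes "rec_fun n f" "rec_fun n g"
  shows "rec_fun n (\<lambda>e. f e ^ g e)"
proof (rule rec_fun_cong)
  have f: "rec_fun (Suc (Suc n)) (\<lambda>e. f (\<lambda>i. e (Suc (Suc i))))"
    using assms(1) by (intro rec_fun_shift)
  show "rec_fun n (\<lambda>e. rec_nat 1 (\<lambda>k r. r * f e) (g e))"
    by (intro rec_fun_rec_nat rec_fun_mult rec_fun_const rec_fun_proj f assms) simp
  have "rec_nat 1 (\<lambda>k r. r * a) b = a ^ b" for a b :: nat
    by (induction b) auto
  then show "f e ^ g e = rec_nat 1 (\<lambda>k r. r * f e) (g e)" for e by simp
qed

lemma rec_fun_pred:
  assumes "rec_fun n f"
  shows "rec_fun n (\<lambda>e. f e - 1)"
proof (rule rec_fun_cong)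
  \<comment> \<open>The step ignores the accumulator and returns the counter, which is one less than
    the recursion argument.\<close>
  show "rec_fun n (\<lambda>e. rec_nat 0 (\<lambda>k r. k) (f e))"
    by (intro rec_fun_rec_nat rec_fun_const rec_fun_proj assms) simp
  have "rec_nat 0 (\<lambda>k r. k) b = b - 1" for b :: nat
    by (cases b) auto
  then show "f e - 1 = rec_nat 0 (\<lambda>k r. k) (f e)" for e by simp
qed

lemma rec_fun_diff:
  assumes "rec_fun n f" "rec_fun n g"
  shows "rec_fun n (\<lambda>e. f e - g e)"
proof (rule rec_fun_cong)
  show "rec_fun n (\<lambda>e. rec_nat (f e) (\<lambda>k r. r - 1) (g e))"
    by (intro rec_fun_rec_nat rec_fun_pred rec_fun_proj assms) simp
  have "rec_nat a (\<lambda>k r. r - 1) b = a - b" for a b :: nat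
    by (induction b) auto
  then show "f e - g e = rec_nat (f e) (\<lambda>k r. r - 1) (g e)" for e by simp
qed

lemma rec_fun_triangle:
  assumes "rec_fun n f"
  shows "rec_fun n (\<lambda>e. triangle (f e))"
proof (rule rec_fun_cong)
  show "rec_fun n (\<lambda>e. rec_nat 0 (\<lambda>k r. r + Suc k) (f e))"
    by (intro rec_fun_rec_nat rec_fun_add rec_fun_Suc rec_fun_const rec_fun_proj assms) simp_all
  have "rec_nat 0 (\<lambda>k r. r + Suc k) b = triangle b" for b
    by (induction b) auto
  then show "triangle (f e) = rec_nat 0 (\<lambda>k r. r + Suc k) (f e)" for e by simp
qed

lemma rec_fun_prod_encode:
  assumes "rec_fun n f" "rec_fun n g"
  shows "rec_fun n (\<lambda>e. prod_encode (f e, g e))"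
  unfolding prod_encode_def prod.case by (intro rec_fun_add rec_fun_triangle assms)

section \<open>Predicates and bounded quantifiers\<close>

lemma rec_pred_eq_0:
  assumes "rec_fun n f"
  shows "rec_pred n (\<lambda>e. f e = 0)"
  unfolding rec_pred_def
proof (rule rec_fun_cong)
  \<comment> \<open>Subtraction is truncated, so this is the zero test.\<close>
  show "rec_fun n (\<lambda>e. 1 - f e)" by (intro rec_fun_diff rec_fun_const assms)
  show "of_bool (f e = 0) = 1 - f e" for e by simp
qed

lemma rec_pred_not:
  assumes "rec_pred n P"
  shows "rec_pred n (\<lambda>e. \<not> P e)"
  by (rule rec_pred_cong[OF rec_pred_eq_0[OF assms[unfolded rec_pred_def]]]) simp

lemma rec_pred_conj:
  assumes "rec_pred n P" "rec_pred n Q"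
  shows "rec_pred n (\<lambda>e. P e \<and> Q e)"
  using rec_fun_mult[OF assms[unfolded rec_pred_def]] by (simp add: rec_pred_def of_bool_conj)

lemma rec_pred_disj:
  assumes "rec_pred n P" "rec_pred n Q"
  shows "rec_pred n (\<lambda>e. P e \<or> Q e)"
  by (rule rec_pred_cong[OF rec_pred_not[OF rec_pred_conj[OF assms[THEN rec_pred_not]]]]) simp

lemma rec_pred_imp:
  assumes "rec_pred n P" "rec_pred n Q"
  shows "rec_pred n (\<lambda>e. P e \<longrightarrow> Q e)"
  by (rule rec_pred_cong[OF rec_pred_disj[OF assms(1)[THEN rec_pred_not] assms(2)]]) simp

lemma rec_pred_iff:
  assumes "rec_pred n P" "rec_pred n Q"
  shows "rec_pred n (\<lambda>e. P e \<longleftrightarrow> Q e)"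
  by (rule rec_pred_cong[OF rec_pred_conj[OF rec_pred_imp[OF assms] rec_pred_imp[OF assms(2,1)]]])
    blast

text \<open>Two numbers are equal when both truncated differences vanish.\<close>

lemma rec_pred_eq:
  assumes "rec_fun n f" "rec_fun n g"
  shows "rec_pred n (\<lambda>e. f e = g e)"
  by (rule rec_pred_cong[OF rec_pred_eq_0[OF rec_fun_add[OF rec_fun_diff[OF assms]
    rec_fun_diff[OF assms(2,1)]]]]) auto

text \<open>Bounded search by primitive recursion: the accumulator becomes 1 at the first witness
  and stays 1.\<close>

lemma rec_pred_ex:
  assumes b: "rec_fun n b" and P: "rec_pred (Suc n) (\<lambda>e. P (e 0) (\<lambda>i. e (Suc i)))"
  shows "rec_pred n (\<lambda>e. \<exists>k<b e. P k e)"
  unfolding rec_pred_def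
proof (rule rec_fun_cong)
  have P': "rec_pred (Suc (Suc n)) (\<lambda>e. P (e 0) (\<lambda>i. e (Suc (Suc i))))"
    using P unfolding rec_pred_def by (rule rec_fun_skip)
  have "rec_fun (Suc (Suc n)) (\<lambda>e. of_bool (\<not> e (Suc 0) = 0 \<or> P (e 0) (\<lambda>i. e (Suc (Suc i)))))"
    unfolding rec_pred_def[symmetric]
    by (intro rec_pred_disj rec_pred_not rec_pred_eq_0 rec_fun_proj P') simp
  then show "rec_fun n (\<lambda>e. rec_nat 0 (\<lambda>k r. of_bool (\<not> r = 0 \<or> P k e)) (b e))"
    by (intro rec_fun_rec_nat rec_fun_const b)
  have count: "rec_nat 0 (\<lambda>k r. of_bool (\<not> r = 0 \<or> Q k)) c = (of_bool (\<exists>k<c. Q k) :: nat)" for Q and c :: nat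
    by (induction c) (auto simp: less_Suc_eq)
  show "of_bool (\<exists>k<b e. P k e) = (rec_nat 0 (\<lambda>k r. of_bool (\<not> r = 0 \<or> P k e)) (b e) :: nat)" for e
    by (rule count[where Q = "\<lambda>k. P k e", symmetric])
qed

lemma rec_pred_all:
  assumes "rec_fun n b" "rec_pred (Suc n) (\<lambda>e. P (e 0) (\<lambda>i. e (Suc i)))"
  shows "rec_pred n (\<lambda>e. \<forall>k<b e. P k e)"
  by (rule rec_pred_cong[OF rec_pred_not[OF rec_pred_ex[OF assms(1) rec_pred_not[OF assms(2)]]]])
    blast

text \<open>Bit \<open>m\<close> is the parity of \<open>x div 2 ^ m\<close>; a search for quotient
  and remainder replaces the division. The bound on \<open>q\<close> suffices because
  \<open>2 * q + 1 \<le> x\<close>.\<close>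

lemma mem_set_decode_iff:
  "m \<in> set_decode x \<longleftrightarrow> (\<exists>q<Suc x. \<exists>r<2 ^ m. x = (2 * q + 1) * 2 ^ m + r)"
proof
  assume "m \<in> set_decode x"
  then obtain q where q: "x div 2 ^ m = 2 * q + 1" by (auto simp: set_decode_def elim: oddE)
  have "2 * q + 1 \<le> x" by (metis q div_le_dividend)
  moreover have "x = (2 * q + 1) * 2 ^ m + x mod 2 ^ m"
    by (metis q div_mult_mod_eq)
  ultimately show "\<exists>q<Suc x. \<exists>r<2 ^ m. x = (2 * q + 1) * 2 ^ m + r"
    by (intro exI[of _ q] conjI exI[of _ "x mod 2 ^ m"]) simp_all
next
  assume "\<exists>q<Suc x. \<exists>r<2 ^ m. x = (2 * q + 1) * 2 ^ m + r"
  then obtain q r where "r < 2 ^ m" "x = r + (2 * q + 1) * 2 ^ m" by (auto simp: add.commute)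
  moreover from this have "x div 2 ^ m = (2 * q + 1) + r div 2 ^ m"
    by (simp only:) (rule div_mult_self1, simp)
  ultimately have "x div 2 ^ m = 2 * q + 1" by simp
  then show "m \<in> set_decode x" by (simp add: set_decode_def)
qed

lemma rec_pred_mem_set_decode:
  assumes "rec_fun n f" "rec_fun n g"
  shows "rec_pred n (\<lambda>e. f e \<in> set_decode (g e))"
proof -
  \<comment> \<open>\<open>f\<close> stands under one binder in the bound of \<open>r\<close>, and
    both functions stand under two binders in the equation.\<close>
  note shift = assms[THEN rec_fun_shift]
  show ?thesis
    unfolding mem_set_decode_iff
    by (intro rec_pred_ex rec_pred_eq rec_fun_add rec_fun_mult rec_fun_power rec_fun_Suc
      rec_fun_const assms shift shift[THEN rec_fun_shift] rec_fun_proj) simp_all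
qed

lemmas rec_intros = rec_pred_not rec_pred_conj rec_pred_disj rec_pred_imp rec_pred_iff rec_pred_eq
  rec_pred_all rec_pred_ex rec_pred_mem_set_decode
  rec_fun_Suc rec_fun_add rec_fun_power rec_fun_prod_encode rec_fun_const rec_fun_proj

text \<open>After unfolding, only connectives, bounded quantifiers and functions already shown
  recursive remain, so the closure rules follow the shape of the formula.\<close>

lemma rec_pred_refutable: "rec_pred 2 (\<lambda>e. refutable (e 0) (e 1))"
  unfolding refutable_def table_def table_bound_def
  by (intro rec_intros) simp_all

(* The type variable 'a is arbitrary, so the second conjunct says that the equations in
   eq_theory TYPE(nat) are exactly those holding in every algebra of relations over every base;
   the first says that a single algorithm decides them. *)
theorem theorem7p2:
  "decidable_eqs (eq_theory TYPE(nat)) \<and> eq_theory TYPE(nat) \<subseteq> eq_theory TYPE('a)"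
proof
  let ?f = "\<lambda>xs :: nat list. of_bool (\<not> refutable (xs ! 0) (xs ! 1)) :: nat"
  have "recursive 2 ?f"
    using rec_pred_not[OF rec_pred_refutable] by (simp add: rec_pred_def rec_fun_def)
  moreover have "?f [trm_code s, trm_code t] = (if (s, t) \<in> eq_theory TYPE(nat) then 1 else 0)"
    for s t by (simp add: refutable_iff)
  ultimately show "decidable_eqs (eq_theory TYPE(nat))"
    unfolding decidable_eqs_def by blast
  show "eq_theory TYPE(nat) \<subseteq> eq_theory TYPE('a)"
    by (rule eq_theory_nat_subset)
qed

end
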